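(* Let $G$ be a directed acyclic graph, $s$ a vertex of $G$, and $T_s$ a depth-first search arborescence of $G$ rooted at $s$. Let $s_1$ be a child of $s$ in $T_s$, let $z$ and $u$ belong to $T_{s_1}$, and let $z$ be a proper ancestor of $u$ in $T_s$, i.e., $z = LCA_{T_s}(z,u)$ and $z\neq u$. Then $s\in J(z,u)$ if and only if $s\in J(z,t)$ for some $t\in\delta_G^-(u)$.
   Context: All paths are directed, and a single vertex counts as a (trivial) directed path. For distinct vertices $u,v$ of $G$, a vertex $s$ is a junction of $u,v$ if there are internally disjoint directed paths $P$ from $s$ to $u$ and $Q$ from $s$ to $v$ in $G$, where internally disjoint means that $s$ is the only vertex common to $P$ and $Q$. $J(u,v)=J(v,u)$ is the set of junctions of $u,v$ in $G$, and $J(u,u)=\emptyset$ by convention. In particular, a proper ancestor $u$ of $v$ lies in $J(u,v)$. $\delta_G^-(u)$ is the set of parents (in-neighbours) of $u$ in $G$, i.e. vertices $t$ with an arc from $t$ to $u$. The arborescence $T_s$ is the rooted directed tree built by a depth-first search of $G$ started at $s$; its vertices are $s$ and all descendants of $s$ in $G$, and its arcs are the tree arcs of the search. For $u\in T_s$, $T_u$ is the subarborescence of $T_s$ rooted at $u$ (consisting of $u$ and all its descendants in $T_s$). $LCA_{T_s}(u,v)$ is the unique lowest common ancestor of $u$ and $v$ in the rooted tree $T_s$ (it equals $u$ if $u$ is an ancestor of $v$ in $T_s$). *)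

theory Defs
  imports "Graph_Theory.Graph_Theory"
begin

(* Parallel arcs are permitted. Note that cycle counts a loop as a cycle, so a dag has no loops. *)
locale dag = fin_digraph +
  assumes acyclic: "\<not> cycle p"

definition parents :: "('a, 'b) pre_digraph \<Rightarrow> 'a \<Rightarrow> 'a set" where
  "parents G u = {t. t \<rightarrow>\<^bsub>G\<^esub> u}"

(* apath: no repeated vertices; the empty arc list is the trivial path. *)
definition junctions :: "('a, 'b) pre_digraph \<Rightarrow> 'a \<Rightarrow> 'a \<Rightarrow> 'a set" where
  "junctions G u v = {s. u \<noteq> v \<and>
     (\<exists>p q. pre_digraph.apath G s p u \<and> pre_digraph.apath G s q v \<and>
        set (pre_digraph.awalk_verts G s p) \<inter> set (pre_digraph.awalk_verts G s q) = {s})}"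

(* A state of the search consists of the stack of active vertices (current vertex first),
   the set of vertices discovered so far, and the set of tree arcs. The order in which the
   outgoing arcs of a vertex are explored is arbitrary, hence a relation. *)
inductive dfs_step ::
    "('a, 'b) pre_digraph \<Rightarrow> 'a list \<times> 'a set \<times> 'b set \<Rightarrow> 'a list \<times> 'a set \<times> 'b set \<Rightarrow> bool"
  for G :: "('a, 'b) pre_digraph" where
  advance: "\<lbrakk>e \<in> out_arcs G u; head G e \<notin> D\<rbrakk> \<Longrightarrow>
     dfs_step G (u # st, D, F) (head G e # u # st, insert (head G e) D, insert e F)"
| retreat: "(\<And>e. e \<in> out_arcs G u \<Longrightarrow> head G e \<in> D) \<Longrightarrow>
     dfs_step G (u # st, D, F) (st, D, F)"

definition dfs_arborescence ::
    "('a, 'b) pre_digraph \<Rightarrow> 'a \<Rightarrow> ('a, 'b) pre_digraph \<Rightarrow> bool" where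
  "dfs_arborescence G s T \<longleftrightarrow>
     (dfs_step G)\<^sup>*\<^sup>* ([s], {s}, {}) ([], verts T, arcs T) \<and>
     tail T = tail G \<and> head T = head G"

definition subarborescence :: "('a, 'b) pre_digraph \<Rightarrow> 'a \<Rightarrow> ('a, 'b) pre_digraph" where
  "subarborescence T u = T \<restriction> {v. u \<rightarrow>\<^sup>*\<^bsub>T\<^esub> v}"

(* Meaningful when T is a rooted tree: then the common ancestors of two vertices form a
   chain, and LCA is its lowest element. *)
definition LCA :: "('a, 'b) pre_digraph \<Rightarrow> 'a \<Rightarrow> 'a \<Rightarrow> 'a" where
  "LCA T u v = (THE w. w \<rightarrow>\<^sup>*\<^bsub>T\<^esub> u \<and> w \<rightarrow>\<^sup>*\<^bsub>T\<^esub> v \<and>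
     (\<forall>x. x \<rightarrow>\<^sup>*\<^bsub>T\<^esub> u \<longrightarrow> x \<rightarrow>\<^sup>*\<^bsub>T\<^esub> v \<longrightarrow> x \<rightarrow>\<^sup>*\<^bsub>T\<^esub> w))"

end

theory Submission
  imports Defs
begin

text \<open>
  Extending a path \<open>s \<rightarrow> t\<close> by an arc \<open>t \<rightarrow> u\<close>, or deleting the last arc of a path \<open>s \<rightarrow> u\<close>, changes
  its vertex set only by \<open>u\<close>, and \<open>u\<close> lies on no path \<open>s \<rightarrow> z\<close>: the tree path from \<open>z\<close> to \<open>u\<close>
  would close a cycle. That tree path exists because lowest common ancestors in a search
  arborescence are well defined, every vertex having at most one incoming tree arc.
\<close>

context dag
begin

lemma not_reachable1_self: "\<not> x \<rightarrow>\<^sup>+ x"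
proof
  assume "x \<rightarrow>\<^sup>+ x"
  then obtain p where "awalk x p x" "p \<noteq> []"
    by (auto simp: reachable1_awalk)
  then have "closed_w p"
    by (auto simp: closed_w_def)
  with closed_w_imp_cycle acyclic show False
    by blast
qed

lemma reachable_antisym:
  assumes "x \<rightarrow>\<^sup>* y" "y \<rightarrow>\<^sup>* x"
  shows "x = y"
  using assms not_reachable1_self
  by (meson reachable_neq_reachable1 reachable1_reachable_trans)

lemma adj_not_reachable:
  assumes "x \<rightarrow> y"
  shows "\<not> y \<rightarrow>\<^sup>* x"
  using assms not_reachable1_self
  by (meson r_into_trancl' reachable1_reachable_trans)

text \<open>The required parent of \<open>u\<close> is the last but one vertex of the path
  \<open>q\<close> to \<open>u\<close>. Deleting the last arc of \<open>q\<close> removes only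
  \<open>u\<close>, so disjointness is inherited.\<close>

lemma junction_parent:
  assumes "s \<in> junctions G z u" "s \<noteq> z" "s \<noteq> u"
  shows "\<exists>t \<in> parents G u. s \<in> junctions G z t"
proof -
  from assms obtain p q where p: "apath s p z" and q: "apath s q u"
    and disj: "set (awalk_verts s p) \<inter> set (awalk_verts s q) = {s}"
    by (auto simp: junctions_def)
  from q \<open>s \<noteq> u\<close> have "q \<noteq> []"
    by (auto simp: apath_simps)
  then obtain q' e where qe: "q = q' @ [e]"
    by (cases q rule: rev_cases) auto
  define t where "t = tail G e"
  have q': "apath s q' t" and e: "e \<in> arcs G" "head G e = u"
    using q unfolding qe t_def by (auto simp: apath_append_iff apath_simps)
  then have "t \<in> parents G u"
    by (auto simp: parents_def t_def intro: in_arcs_imp_in_arcs_ends)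
  moreover have sub: "set (awalk_verts s q') \<subseteq> set (awalk_verts s q)"
    using q awalk_verts_append[of s q' "[e]" u] by (auto simp: apath_def qe)
  have "set (awalk_verts s p) \<inter> set (awalk_verts s q') = {s}"
    using sub disj hd_in_awalk_verts(2)[OF p] hd_in_awalk_verts(2)[OF q'] by blast
  \<comment> \<open>\<open>junctions\<close> demands distinct targets. If \<open>z = t\<close>, then
    \<open>z\<close> would lie on both original paths and so be \<open>s\<close>.\<close>
  moreover have "z \<noteq> t"
  proof
    assume "z = t"
    then have "z \<in> set (awalk_verts s p) \<inter> set (awalk_verts s q')"
      using p q' by (auto simp: apath_def)
    with sub have "z \<in> set (awalk_verts s p) \<inter> set (awalk_verts s q)"
      by blast
    with disj \<open>s \<noteq> z\<close> show False
      by simp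
  qed
  ultimately show ?thesis
    using p q' by (auto simp: junctions_def)
qed

lemma junction_child:
  assumes "s \<in> junctions G z t" "t \<in> parents G u" "z \<rightarrow>\<^sup>* u" "z \<noteq> u"
  shows "s \<in> junctions G z u"
proof -
  from assms obtain p q where p: "apath s p z" and q: "apath s q t"
    and disj: "set (awalk_verts s p) \<inter> set (awalk_verts s q) = {s}"
    by (auto simp: junctions_def)
  from assms obtain e where e: "e \<in> arcs G" "tail G e = t" "head G e = u"
    by (auto simp: parents_def)
  \<comment> \<open>Every vertex of \<open>p\<close> reaches its end \<open>z\<close>; since
    \<open>z\<close> reaches \<open>u\<close>, finding \<open>u\<close> there would force
    \<open>z = u\<close>.\<close>
  have u_p: "u \<notin> set (awalk_verts s p)"
    using awalk_verts_reachable_to[of s p z u] p assms(3,4) reachable_antisym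
    by (auto simp: apath_def)
  \<comment> \<open>Needed for the extended walk to remain a path: a vertex of \<open>q\<close>
    reaches \<open>t\<close>, which \<open>u\<close> cannot do because of the arc from
    \<open>t\<close> to \<open>u\<close>.\<close>
  have u_q: "u \<notin> set (awalk_verts s q)"
    using awalk_verts_reachable_to[of s q t u] q assms(2) adj_not_reachable
    by (auto simp: apath_def parents_def)
  have w: "awalk s (q @ [e]) u"
    using q e by (auto simp: apath_def awalk_simps)
  then have vs: "awalk_verts s (q @ [e]) = awalk_verts s q @ [u]"
    using awalk_verts_append[of s q "[e]" u] e by simp
  have "apath s (q @ [e]) u"
    using q u_q w vs by (simp add: apath_def)
  moreover have "set (awalk_verts s p) \<inter> set (awalk_verts s (q @ [e])) = {s}"
    using disj u_p vs by auto
  ultimately show ?thesis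
    using p \<open>z \<noteq> u\<close> by (auto simp: junctions_def)
qed

end

text \<open>The goal is the last conjunct, at most one tree arc into each vertex. It survives an
  advance because old heads lie in \<open>D\<close> while the new head does not. The stack condition
  puts the tail of the new arc into \<open>D\<close>.\<close>

definition dfs_inv ::
    "('a, 'b) pre_digraph \<Rightarrow> 'a list \<times> 'a set \<times> 'b set \<Rightarrow> bool" where
  "dfs_inv G = (\<lambda>(st, D, F). set st \<subseteq> D \<and> D \<subseteq> verts G \<and> F \<subseteq> arcs G \<and>
     tail G ` F \<subseteq> D \<and> head G ` F \<subseteq> D \<and> inj_on (head G) F)"

lemma (in wf_digraph) dfs_step_inv:
  assumes "dfs_step G x y" "dfs_inv G x"
  shows "dfs_inv G y"
  using assms by cases (auto simp: dfs_inv_def)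

lemma (in wf_digraph) dfs_arborescence_inv:
  assumes "dfs_arborescence G s T" "s \<in> verts G"
  shows "dfs_inv G ([], verts T, arcs T)"
proof -
  have "(dfs_step G)\<^sup>*\<^sup>* ([s], {s}, {}) ([], verts T, arcs T)"
    using assms by (simp add: dfs_arborescence_def)
  then show ?thesis
  proof induction
    case base
    with assms(2) show ?case
      by (simp add: dfs_inv_def)
  next
    case (step x y)
    then show ?case
      by (blast intro: dfs_step_inv)
  qed
qed

lemma (in wf_digraph) dfs_arborescence_subgraph:
  assumes "dfs_arborescence G s T" "s \<in> verts G"
  shows "subgraph T G"
proof -
  have ht: "tail T = tail G" "head T = head G"
    using assms by (simp_all add: dfs_arborescence_def)
  with dfs_arborescence_inv[OF assms] have "wf_digraph T"
    by unfold_locales (auto simp: dfs_inv_def)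
  with ht dfs_arborescence_inv[OF assms] wf_digraph_axioms show ?thesis
    by (auto simp: subgraph_def compatible_def dfs_inv_def)
qed

lemma (in wf_digraph) dfs_arborescence_inj_head:
  assumes "dfs_arborescence G s T" "s \<in> verts G"
  shows "inj_on (head T) (arcs T)"
  using dfs_arborescence_inv[OF assms] assms(1)
  by (simp add: dfs_arborescence_def dfs_inv_def)

text \<open>Induction along a path from the common ancestor \<open>c\<close> to \<open>z\<close>. If
  the current end reaches \<open>u\<close>, it is itself the lowest one. Otherwise every common
  ancestor lies strictly above it, hence reaches its only parent, and the lowest common ancestor for
  that parent still serves.\<close>

lemma (in wf_digraph) ex_lowest_common_ancestor:
  assumes inj: "inj_on (head G) (arcs G)"
    and z: "c \<rightarrow>\<^sup>* z" and u: "c \<rightarrow>\<^sup>* u"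
  shows "\<exists>w. w \<rightarrow>\<^sup>* z \<and> w \<rightarrow>\<^sup>* u \<and> (\<forall>x. x \<rightarrow>\<^sup>* z \<longrightarrow> x \<rightarrow>\<^sup>* u \<longrightarrow> x \<rightarrow>\<^sup>* w)"
  using z
proof (induction rule: reachable_induct)
  case base
  with u show ?case by blast
next
  case (step y z)
  then obtain w where w: "w \<rightarrow>\<^sup>* y" "w \<rightarrow>\<^sup>* u"
    and low: "\<And>x. x \<rightarrow>\<^sup>* y \<Longrightarrow> x \<rightarrow>\<^sup>* u \<Longrightarrow> x \<rightarrow>\<^sup>* w"
    by blast
  show ?case
  proof (cases "z \<rightarrow>\<^sup>* u")
    case True
    with step.hyps show ?thesis
      by (metis adj_in_verts(2) reachable_refl)
  next
    case False
    have "x \<rightarrow>\<^sup>* w" if x: "x \<rightarrow>\<^sup>* z" "x \<rightarrow>\<^sup>* u" for x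
    proof -
      have "x \<noteq> z"
        using x False by blast
      with x(1) obtain y' where y': "x \<rightarrow>\<^sup>* y'" "y' \<rightarrow> z"
        by (induction rule: reachable_induct) auto
      \<comment> \<open>Two arcs with head \<open>z\<close> coincide by injectivity, and so do their
        tails.\<close>
      with inj \<open>y \<rightarrow> z\<close> have "y' = y"
        by (auto simp: arcs_ends_conv dest: inj_onD)
      with y' x low show ?thesis
        by blast
    qed
    moreover have "w \<rightarrow>\<^sup>* z"
      using w(1) \<open>y \<rightarrow> z\<close> by (rule reachable_adj_trans)
    ultimately show ?thesis
      using w(2) by blast
  qed
qed

text \<open>\<open>LCA\<close> is a definite description, so its properties are available only after
  unique existence; antisymmetry yields the uniqueness.\<close>

lemma LCA_reachable:
  assumes ex: "\<exists>w. w \<rightarrow>\<^sup>*\<^bsub>T\<^esub> z \<and> w \<rightarrow>\<^sup>*\<^bsub>T\<^esub> u \<and>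
      (\<forall>x. x \<rightarrow>\<^sup>*\<^bsub>T\<^esub> z \<longrightarrow> x \<rightarrow>\<^sup>*\<^bsub>T\<^esub> u \<longrightarrow> x \<rightarrow>\<^sup>*\<^bsub>T\<^esub> w)"
    and antisym: "\<And>x y. x \<rightarrow>\<^sup>*\<^bsub>T\<^esub> y \<Longrightarrow> y \<rightarrow>\<^sup>*\<^bsub>T\<^esub> x \<Longrightarrow> x = y"
  shows "LCA T z u \<rightarrow>\<^sup>*\<^bsub>T\<^esub> u"
proof -
  have "\<exists>!w. w \<rightarrow>\<^sup>*\<^bsub>T\<^esub> z \<and> w \<rightarrow>\<^sup>*\<^bsub>T\<^esub> u \<and>
      (\<forall>x. x \<rightarrow>\<^sup>*\<^bsub>T\<^esub> z \<longrightarrow> x \<rightarrow>\<^sup>*\<^bsub>T\<^esub> u \<longrightarrow> x \<rightarrow>\<^sup>*\<^bsub>T\<^esub> w)"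
    using ex antisym by blast
  from theI'[OF this] show ?thesis
    unfolding LCA_def by blast
qed

theorem lemma3:
  fixes G T :: "('a, 'b) pre_digraph" and s s\<^sub>1 z u :: 'a
  assumes "dag G"
    and "s \<in> verts G"
    and "dfs_arborescence G s T"
    and "s \<rightarrow>\<^bsub>T\<^esub> s\<^sub>1"
    and "z \<in> verts (subarborescence T s\<^sub>1)"
    and "u \<in> verts (subarborescence T s\<^sub>1)"
    and "z = LCA T z u"
    and "z \<noteq> u"
  shows "s \<in> junctions G z u \<longleftrightarrow> (\<exists>t \<in> parents G u. s \<in> junctions G z t)"
proof -
  interpret dag G by fact
  have sub: "subgraph T G"
    using assms(2,3) by (intro dfs_arborescence_subgraph)
  then interpret T: wf_digraph T
    by (simp add: subgraph_def)
  have reach_G: "x \<rightarrow>\<^sup>*\<^bsub>G\<^esub> y" if "x \<rightarrow>\<^sup>*\<^bsub>T\<^esub> y" for x y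
    using that sub by (rule reachable_mono)
  have z: "s\<^sub>1 \<rightarrow>\<^sup>*\<^bsub>T\<^esub> z" and u: "s\<^sub>1 \<rightarrow>\<^sup>*\<^bsub>T\<^esub> u"
    using assms(5,6) by (simp_all add: subarborescence_def)
  \<comment> \<open>The common ancestor supplied is \<open>s\<^sub>1\<close>; antisymmetry in
    \<open>T\<close> is inherited from the acyclic \<open>G\<close>.\<close>
  have "LCA T z u \<rightarrow>\<^sup>*\<^bsub>T\<^esub> u"
    using T.ex_lowest_common_ancestor[OF dfs_arborescence_inj_head[OF assms(3,2)] z u]
    by (rule LCA_reachable) (blast intro: reachable_antisym reach_G)
  then have zu: "z \<rightarrow>\<^sup>*\<^bsub>G\<^esub> u"
    using assms(7) reach_G by simp
  have "s \<rightarrow>\<^bsub>G\<^esub> s\<^sub>1"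
    using assms(4) sub by (rule adj_mono)
  \<comment> \<open>Both vertices are reachable from \<open>s\<^sub>1\<close>, whereas
    \<open>s\<close> is not, by the arc from \<open>s\<close> to \<open>s\<^sub>1\<close>.\<close>
  then have "s \<noteq> z" "s \<noteq> u"
    using adj_not_reachable reach_G z u by blast+
  with zu \<open>z \<noteq> u\<close> show ?thesis
    using junction_parent junction_child by blast
qed

end
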